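(* Let $$x(t)=\frac{1-3t+2t^2-t^3-\sqrt{1-10t+37t^2-62t^3+46t^4-12t^5+t^6}}{2t(1-3t+t^2)}\quad\text{and}\quad k(t;x)=1+\frac{x^2t}{1-x}+\frac{xt^3}{(1-t)(1-2t)}.$$ Then $$\sum_{n\geq1}c_n(21\text{-}3)t^n=\frac{(x(t)-1)\left(1+\sum_{j\geq1}\frac{t^{\binom{j}{2}+3j}x(t)^j}{(1-t)^{\binom{j+1}{2}}(1-2t)^j\prod_{i=1}^jk\left(t;\frac{x(t)t^i}{(1-t)^i}\right)}\right)}{1+(1-x(t))\sum_{j\geq1}\frac{t^{\binom{j}{2}+3j}x(t)^j}{(1-t)^{\binom{j}{2}}(1-2t)^j\left((1-t)^j-x(t)t^j\right)\prod_{i=1}^jk\left(t;\frac{x(t)t^i}{(1-t)^i}\right)}}.$$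
   Context: A Catalan word of length $n\ge 1$ is a sequence $\pi=\pi_1\cdots\pi_n$ of positive integers with $\pi_1=1$ and $\pi_{i+1}\le \pi_i+1$ for $1\le i\le n-1$; $\mathcal{C}_n$ is the set of these. Two sequences of the same length are order-isomorphic if their corresponding pairs of entries stand in the same relation ($<$, $>$ or $=$). A word $\pi$ contains the vincular pattern $xy\text{-}z$ if there are indices $i,j$ with $i+1<j\le n$ such that $\pi_i\pi_{i+1}\pi_j$ is order-isomorphic to $xyz$ (the first two letters must be adjacent in $\pi$); otherwise $\pi$ avoids it. $c_n(\tau)$ denotes the number of members of $\mathcal{C}_n$ avoiding $\tau$. The identity is one of power series in $t$ (all expressions expanded about $t=0$, the square root having constant term $1$); $\binom{1}{2}=0$. *)

theory Defs
  imports "HOL-Computational_Algebra.Formal_Power_Series"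
begin

text \<open>Words are lists of natural numbers, indexed from 0.\<close>

definition catalan_words :: "nat \<Rightarrow> nat list set" where
  "catalan_words n = {w. length w = n \<and> n \<ge> 1 \<and> (\<forall>a\<in>set w. a \<ge> 1) \<and> w ! 0 = 1 \<and>
     (\<forall>i. Suc i < n \<longrightarrow> w ! Suc i \<le> w ! i + 1)}"

definition order_isomorphic :: "nat list \<Rightarrow> nat list \<Rightarrow> bool" where
  "order_isomorphic u v \<longleftrightarrow> length u = length v \<and>
     (\<forall>i<length u. \<forall>j<length u.
        (u ! i < u ! j \<longleftrightarrow> v ! i < v ! j) \<and>
        (u ! i > u ! j \<longleftrightarrow> v ! i > v ! j) \<and>
        (u ! i = u ! j \<longleftrightarrow> v ! i = v ! j))"

text \<open>The triple \<open>(x, y, z)\<close> encodes the vincular pattern \<open>xy-z\<close>: the letters playing the roles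
  of \<open>x\<close> and \<open>y\<close> are adjacent, the one playing \<open>z\<close> occurs anywhere to their right.\<close>

definition contains_vincular :: "nat list \<Rightarrow> nat \<times> nat \<times> nat \<Rightarrow> bool" where
  "contains_vincular w = (\<lambda>(x, y, z). \<exists>i j. i + 1 < j \<and> j < length w \<and>
     order_isomorphic [w ! i, w ! (i + 1), w ! j] [x, y, z])"

definition avoid_count :: "nat \<times> nat \<times> nat \<Rightarrow> nat \<Rightarrow> nat" where
  "avoid_count \<tau> n = card {w \<in> catalan_words n. \<not> contains_vincular w \<tau>}"

abbreviation t :: "real fps" where
  "t \<equiv> fps_X"

text \<open>\<open>fps_radical root 2\<close> is the square root whose constant term is the real square root of the
  constant term of the argument, here 1 (see \<open>radicand_sqrt\<close>).\<close>

definition radicand :: "real fps" where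
  "radicand = 1 - 10*t + 37*t^2 - 62*t^3 + 46*t^4 - 12*t^5 + t^6"

definition xt :: "real fps" where
  "xt = (1 - 3*t + 2*t^2 - t^3 - fps_radical root 2 radicand) / (2*t*(1 - 3*t + t^2))"

definition k_fps :: "real fps \<Rightarrow> real fps" where
  "k_fps x = 1 + x^2 * t / (1 - x) + x * t^3 / ((1 - t) * (1 - 2*t))"

text \<open>The summands of the two series over \<open>j \<ge> 1\<close>. Below, the series are taken in the
  \<open>t\<close>-adic metric of \<^typ>\<open>real fps\<close>.\<close>

definition num_term :: "nat \<Rightarrow> real fps" where
  "num_term j = t ^ ((j choose 2) + 3*j) * xt ^ j /
     ((1 - t) ^ ((j + 1) choose 2) * (1 - 2*t) ^ j *
      (\<Prod>i=1..j. k_fps (xt * t^i / (1 - t)^i)))"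

definition den_term :: "nat \<Rightarrow> real fps" where
  "den_term j = t ^ ((j choose 2) + 3*j) * xt ^ j /
     ((1 - t) ^ (j choose 2) * (1 - 2*t) ^ j * ((1 - t)^j - xt * t^j) *
      (\<Prod>i=1..j. k_fps (xt * t^i / (1 - t)^i)))"

text \<open>The square root, the quotient \<open>xt\<close> and the series are well defined: the root squares back,
  the division by \<open>2t(1 - 3t + t\<^sup>2)\<close> is exact, all other divisors have constant term 1, and the
  series converge.\<close>

lemma radicand_sqrt:
  "fps_radical root 2 radicand ^ 2 = radicand" "fps_nth (fps_radical root 2 radicand) 0 = 1"
proof -
  have "fps_nth radicand 0 = 1"
    by (simp add: radicand_def)
  then show "fps_radical root 2 radicand ^ 2 = radicand"
    using power_radical[of radicand root 1] by (simp add: numeral_2_eq_2)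
  show "fps_nth (fps_radical root 2 radicand) 0 = 1"
    using \<open>fps_nth radicand 0 = 1\<close> by (simp add: fps_radical_def numeral_2_eq_2)
qed

lemma xt_exact:
  "xt * (2*t*(1 - 3*t + t^2)) = 1 - 3*t + 2*t^2 - t^3 - fps_radical root 2 radicand"
proof -
  have "is_unit (1 - 3*t + t^2)" "is_unit (2 :: real fps)"
    by (simp_all add: fps_is_unit_iff numeral_fps_const)
  moreover have "t dvd f" if "fps_nth f 0 = 0" for f :: "real fps"
    by (rule dvdI[of _ _ "fps_shift 1 f"], rule fps_ext) (use that in auto)
  then have "t dvd 1 - 3*t + 2*t^2 - t^3 - fps_radical root 2 radicand"
    using radicand_sqrt(2) by simp
  ultimately have "2*t*(1 - 3*t + t^2) dvd 1 - 3*t + 2*t^2 - t^3 - fps_radical root 2 radicand"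
    by (simp add: mult_unit_dvd_iff mult_unit_dvd_iff')
  then show ?thesis unfolding xt_def by (rule dvd_div_mult_self)
qed

lemma k_fps_nth_0:
  assumes "fps_nth x 0 = 0"
  shows "fps_nth (k_fps x) 0 = 1"
  using assms by (simp add: k_fps_def)

lemma prod_k_nth_0: "fps_nth (\<Prod>i=1..j. k_fps (xt * t^i / (1 - t)^i)) 0 = 1"
proof -
  have "fps_nth (k_fps (xt * t^i / (1 - t)^i)) 0 = 1" if "i \<ge> 1" for i
    using that by (intro k_fps_nth_0) (simp add: fps_divide_nth_0)
  moreover have "fps_nth (prod f A) 0 = (\<Prod>i\<in>A. fps_nth (f i) 0)"
    for f :: "nat \<Rightarrow> real fps" and A
    by (induction A rule: infinite_finite_induct) auto
  ultimately show ?thesis by simp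
qed

lemma summable_fps:
  fixes f :: "nat \<Rightarrow> real fps"
  assumes "\<And>n j. n < j \<Longrightarrow> fps_nth (f j) n = 0"
  shows "summable f"
proof -
  have "(\<lambda>m. \<Sum>j<m. f j) \<longlonglongrightarrow> Abs_fps (\<lambda>n. \<Sum>j\<le>n. fps_nth (f j) n)"
  proof (rule tendsto_fpsI)
    fix n
    have "fps_nth (\<Sum>j<m. f j) n = (\<Sum>j\<le>n. fps_nth (f j) n)" if "m > n" for m
      unfolding fps_sum_nth by (rule sum.mono_neutral_right) (use that assms in auto)
    then show "eventually (\<lambda>m. fps_nth (\<Sum>j<m. f j) n =
        fps_nth (Abs_fps (\<lambda>n. \<Sum>j\<le>n. fps_nth (f j) n)) n) sequentially"
      by (auto intro: eventually_mono[OF eventually_gt_at_top[of n]])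
  qed
  then show ?thesis by (auto simp: summable_def sums_def)
qed

lemma summable_terms: "summable (\<lambda>j. num_term (Suc j))" "summable (\<lambda>j. den_term (Suc j))"
proof -
  have *: "fps_nth (t ^ m * a / b) n = 0" if "fps_nth b 0 \<noteq> 0" "n < m" for m n a b
    using that by (simp add: fps_divide_unit mult.assoc fps_X_power_mult_nth)
  show "summable (\<lambda>j. num_term (Suc j))"
    unfolding num_term_def
    by (intro summable_fps *) (simp_all add: prod_k_nth_0[simplified] del: prod.cl_ivl_Suc)
  show "summable (\<lambda>j. den_term (Suc j))"
    unfolding den_term_def
    by (intro summable_fps *) (simp_all add: prod_k_nth_0[simplified] del: prod.cl_ivl_Suc)
qed

end

theory Submission
  imports Defs
begin

text \<open>A Catalan word avoids 21-3 iff no letter exceeds the top of an earlier descent. Adding letters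
  at the right end one at a time therefore only requires knowing the last letter and the smallest
  descent top so far. Let \<open>T\<^sub>m\<close> (\<open>above_gf m\<close>) count the avoiders whose last letter exceeds \<open>m\<close>, so
  that \<open>T\<^sub>0\<close> is the series to be computed. With \<open>u = t/(1 - t)\<close>, the removal of last letters gives a
  two-term recurrence between \<open>T\<^sub>n\<close> and \<open>T\<^sub>n\<^sub>+\<^sub>1\<close> with a coefficient involving \<open>u\<^sup>n\<close>
  (\<open>above_gf_recurrence\<close>). Multiplied by powers of \<open>y\<close> and summed, it becomes a functional equation
  that relates the generating function \<open>H(y)\<close> of the avoiders, with \<open>y\<close> marking the value of the
  last letter, to \<open>H(u y)\<close> (\<open>letter_transform_functional_equation\<close>):

    \<open>H(y) (1 - y) k(t; y) = t y (1 - y + T\<^sub>0 + v (1 - y) H(u y))\<close>, where \<open>v = t/(1 - 2t)\<close>.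

  The rest is the kernel method. The radicand is the square of \<open>1 - 5t + 6t\<^sup>2 - t\<^sup>3\<close>, so \<open>x(t)\<close> is
  the rational series \<open>(1 - 2t)/(1 - 3t + t\<^sup>2)\<close>, and it is a root of the kernel \<open>(1 - y) k(t; y)\<close>, which
  factors completely (\<open>kernel_factors\<close>). At this root the equation expresses \<open>T\<^sub>0\<close> by \<open>H(u x(t))\<close>
  (\<open>above_gf_0_eq\<close>). At the points \<open>u\<^sup>j x(t)\<close> with \<open>j \<ge> 1\<close>, whose constant term vanishes, the kernel
  is invertible, and the equation expresses \<open>H(u\<^sup>j x(t))\<close> by \<open>H(u\<^sup>j\<^sup>+\<^sup>1 x(t))\<close>. Iterating,
  the accumulated coefficients are exactly the summands of the numerator series, and those of the
  denominator series carry an additional factor \<open>1/(1 - u\<^sup>j x(t))\<close> coming from \<open>T\<^sub>0/(1 - y)\<close>. The iteration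
  converges \<open>t\<close>-adically, and the resulting equation is linear in \<open>T\<^sub>0\<close>.\<close>

section \<open>Words avoiding 21-3\<close>

definition avoiders :: "nat \<Rightarrow> nat list set" where
  "avoiders n = {w \<in> catalan_words n. \<not> contains_vincular w (2, 1, 3)}"

definition descent_tops :: "nat list \<Rightarrow> nat set" where
  "descent_tops w = {w ! i | i. Suc i < length w \<and> w ! Suc i < w ! i}"

lemma descent_tops_single [simp]: "descent_tops [c] = {}"
  by (simp add: descent_tops_def)

lemma descent_tops_snoc:
  assumes "w \<noteq> []"
  shows "descent_tops (w @ [c]) = descent_tops w \<union> (if c < last w then {last w} else {})"
proof -
  have "(\<exists>i. x = (w @ [c]) ! i \<and> Suc i < length (w @ [c]) \<and> (w @ [c]) ! Suc i < (w @ [c]) ! i) \<longleftrightarrow>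
     (\<exists>i. x = w ! i \<and> Suc i < length w \<and> w ! Suc i < w ! i) \<or> (x = last w \<and> c < last w)" for x
  proof -
    have "(\<exists>i. x = (w @ [c]) ! i \<and> Suc i < length (w @ [c]) \<and> (w @ [c]) ! Suc i < (w @ [c]) ! i) \<longleftrightarrow>
      (\<exists>i. (Suc i < length w \<or> i = length w - 1) \<and> x = (w @ [c]) ! i \<and> (w @ [c]) ! Suc i < (w @ [c]) ! i)"
      using assms by (cases w) (auto simp: less_Suc_eq)
    also have "\<dots> \<longleftrightarrow> (\<exists>i. x = w ! i \<and> Suc i < length w \<and> w ! Suc i < w ! i)
      \<or> (x = last w \<and> c < last w)"
      using assms by (auto simp: nth_append last_conv_nth)
    finally show ?thesis .
  qed
  then show ?thesis
    by (auto simp: descent_tops_def)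
qed

lemma contains_21_3_iff:
  "contains_vincular w (2, 1, 3) \<longleftrightarrow>
     (\<exists>i j. Suc i < j \<and> j < length w \<and> w ! Suc i < w ! i \<and> w ! i < w ! j)"
proof -
  have "order_isomorphic [a, b, c] [2, 1, 3] \<longleftrightarrow> b < a \<and> a < c" for a b c :: nat
    by (auto simp: order_isomorphic_def numeral_3_eq_3 All_less_Suc)
  then show ?thesis
    by (simp add: contains_vincular_def)
qed

text \<open>A new occurrence of the pattern must use the appended letter as its 3, since the other two
  letters are adjacent and to the left of it.\<close>

lemma contains_21_3_snoc:
  "contains_vincular (w @ [c]) (2, 1, 3) \<longleftrightarrow>
     contains_vincular w (2, 1, 3) \<or> (\<exists>d\<in>descent_tops w. d < c)"
proof
  assume "contains_vincular (w @ [c]) (2, 1, 3)"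
  then obtain i j where ij: "Suc i < j" "j < Suc (length w)"
    "(w @ [c]) ! Suc i < (w @ [c]) ! i" "(w @ [c]) ! i < (w @ [c]) ! j"
    unfolding contains_21_3_iff by auto
  show "contains_vincular w (2, 1, 3) \<or> (\<exists>d\<in>descent_tops w. d < c)"
  proof (cases "j = length w")
    case True
    with ij have "w ! i \<in> descent_tops w" "w ! i < c"
      by (auto simp: descent_tops_def nth_append)
    then show ?thesis by blast
  next
    case False
    with ij have "j < length w" "w ! Suc i < w ! i" "w ! i < w ! j"
      by (simp_all add: nth_append)
    with ij(1) show ?thesis unfolding contains_21_3_iff by blast
  qed
next
  assume "contains_vincular w (2, 1, 3) \<or> (\<exists>d\<in>descent_tops w. d < c)"
  then show "contains_vincular (w @ [c]) (2, 1, 3)"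
  proof
    assume "contains_vincular w (2, 1, 3)"
    then obtain i j where "Suc i < j" "j < length w" "w ! Suc i < w ! i" "w ! i < w ! j"
      unfolding contains_21_3_iff by auto
    then show ?thesis
      unfolding contains_21_3_iff by (intro exI[of _ i] exI[of _ j]) (simp add: nth_append)
  next
    assume "\<exists>d\<in>descent_tops w. d < c"
    then obtain i where "Suc i < length w" "w ! Suc i < w ! i" "w ! i < c"
      by (auto simp: descent_tops_def)
    then show ?thesis
      unfolding contains_21_3_iff
      by (intro exI[of _ i] exI[of _ "length w"]) (simp add: nth_append)
  qed
qed

lemma catalan_words_snoc:
  assumes "w \<noteq> []"
  shows "w @ [c] \<in> catalan_words (Suc n) \<longleftrightarrow> w \<in> catalan_words n \<and> 1 \<le> c \<and> c \<le> last w + 1"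
proof (cases "length w = n")
  case True
  then have n: "n > 0" "last w = w ! (n - 1)"
    using assms by (auto simp: last_conv_nth)
  have "(\<forall>i. Suc i < Suc n \<longrightarrow> (w @ [c]) ! Suc i \<le> (w @ [c]) ! i + 1) \<longleftrightarrow>
        (\<forall>i. (Suc i < n \<or> i = n - 1) \<longrightarrow> (w @ [c]) ! Suc i \<le> (w @ [c]) ! i + 1)"
    using n by (cases n) (auto simp: less_Suc_eq)
  also have "\<dots> \<longleftrightarrow> (\<forall>i. Suc i < n \<longrightarrow> w ! Suc i \<le> w ! i + 1) \<and> c \<le> last w + 1"
    using n True by (auto simp: nth_append)
  finally show ?thesis
    using True n assms by (auto simp: catalan_words_def nth_append)
qed (auto simp: catalan_words_def)

lemma avoiders_snoc:
  assumes "w \<noteq> []"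
  shows "w @ [c] \<in> avoiders (Suc n) \<longleftrightarrow>
    w \<in> avoiders n \<and> 1 \<le> c \<and> c \<le> last w + 1 \<and> (\<forall>d\<in>descent_tops w. c \<le> d)"
  using assms
  by (auto simp: avoiders_def catalan_words_snoc contains_21_3_snoc not_less simp del: One_nat_def)

lemma avoiders_0 [simp]: "avoiders 0 = {}"
  by (auto simp: avoiders_def catalan_words_def)

lemma avoiders_1: "avoiders (Suc 0) = {[1]}"
  by (auto simp: avoiders_def catalan_words_def contains_21_3_iff[simplified] length_Suc_conv)

lemma avoidersD:
  assumes "w \<in> avoiders n"
  shows "length w = n" "w \<noteq> []" "last w \<ge> 1"
proof -
  show "length w = n" "w \<noteq> []"
    using assms by (auto simp: avoiders_def catalan_words_def)
  moreover have "\<forall>a\<in>set w. a \<ge> 1"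
    using assms by (simp add: avoiders_def catalan_words_def)
  ultimately show "last w \<ge> 1" by simp
qed

lemma avoiders_letters: "w \<in> avoiders n \<Longrightarrow> set w \<subseteq> {..n}"
proof (induction w arbitrary: n rule: rev_induct)
  case (snoc c w)
  show ?case
  proof (cases "w = []")
    case True
    then show ?thesis using snoc.prems by (auto simp: avoiders_def catalan_words_def)
  next
    case False
    then obtain m where m: "n = Suc m"
      using avoidersD(1)[OF snoc.prems] by (cases n) auto
    with snoc.prems False have "w \<in> avoiders m" "c \<le> last w + 1"
      by (auto simp: avoiders_snoc)
    moreover from this have "last w \<le> m"
      using snoc.IH[of m] False last_in_set by blast
    ultimately show ?thesis using snoc.IH[of m] m by auto
  qed
qed simp

lemma avoiders_last_le: "w \<in> avoiders n \<Longrightarrow> last w \<le> n"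
  using avoiders_letters[of w n] avoidersD(2)[of w n] last_in_set by fastforce

lemma finite_avoiders: "finite (avoiders n)"
proof (rule finite_subset)
  show "avoiders n \<subseteq> {w. set w \<subseteq> {..n} \<and> length w = n}"
    using avoiders_letters avoidersD(1) by blast
qed (simp add: finite_lists_length_eq)

text \<open>The last letter is either the bottom of the descent, hence smaller than its top, or comes
  later, and then the pattern would occur if it were larger than the top.\<close>

lemma avoiders_last_le_descent_tops:
  "w \<in> avoiders n \<Longrightarrow> d \<in> descent_tops w \<Longrightarrow> last w \<le> d"
proof (induction w arbitrary: n rule: rev_induct)
  case (snoc c w)
  show ?case
  proof (cases "w = []")
    case False
    then obtain m where m: "n = Suc m"
      using avoidersD(1)[OF snoc.prems(1)] by (cases n) auto
    then show ?thesis
      using snoc.prems False by (auto simp: avoiders_snoc descent_tops_snoc split: if_splits)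
  qed (use snoc.prems in simp)
qed (simp add: descent_tops_def)

text \<open>The bound \<open>m\<close> on the descent tops is the permission to append, as long as no new descent
  occurs, letters up to \<open>m\<close>. For \<open>m = a\<close> it is automatic.\<close>

definition ending :: "nat \<Rightarrow> nat \<Rightarrow> nat \<Rightarrow> nat list set" where
  "ending m a n = {w \<in> avoiders n. last w = a \<and> (\<forall>d\<in>descent_tops w. m \<le> d)}"

definition ending_above :: "nat \<Rightarrow> nat \<Rightarrow> nat list set" where
  "ending_above m n = {w \<in> avoiders n. m < last w}"

lemma finite_ending [simp]: "finite (ending m a n)" "finite (ending_above m n)"
  by (simp_all add: ending_def ending_above_def finite_avoiders)

text \<open>The three sets correspond to the steps level, up and down into the last letter \<open>a\<close>. In the
  last case the preceding letter is itself a descent top, and it is at most all earlier descent tops,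
  so the only condition is that it is at least \<open>m\<close> and greater than \<open>a\<close>.\<close>

lemma ending_Suc:
  assumes "n \<ge> 1" "1 \<le> a" "a \<le> m"
  shows "ending m a (Suc n) =
    (\<lambda>w. w @ [a]) ` (ending m a n \<union> ending m (a - 1) n \<union> ending_above (max (m - 1) a) n)"
proof -
  have snoc: "w @ [c] \<in> ending m a (Suc n) \<longleftrightarrow> c = a \<and>
    w \<in> ending m a n \<union> ending m (a - 1) n \<union> ending_above (max (m - 1) a) n" for w c
  proof (cases "w \<in> avoiders n \<and> c = a")
    case True
    have "w \<noteq> []" and ge: "\<forall>d\<in>descent_tops w. last w \<le> d"
      using True avoidersD avoiders_last_le_descent_tops by blast+
    consider "last w + 1 < a" | "last w = a" | "last w = a - 1" "last w < a" | "last w > a"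
      by linarith
    then show ?thesis
    proof cases
      case 4
      then have "(\<forall>d\<in>descent_tops w. a \<le> d)" using ge by fastforce
      then have "w @ [c] \<in> ending m a (Suc n) \<longleftrightarrow> (\<forall>d\<in>descent_tops w. m \<le> d) \<and> m \<le> last w"
        using True 4 assms \<open>w \<noteq> []\<close> by (auto simp: ending_def avoiders_snoc descent_tops_snoc)
      also have "\<dots> \<longleftrightarrow> m \<le> last w" using ge by fastforce
      finally show ?thesis
        using True 4 by (auto simp: ending_def ending_above_def)
    qed (use True assms \<open>w \<noteq> []\<close> in
        \<open>force simp: ending_def ending_above_def avoiders_snoc descent_tops_snoc\<close>)+
  next
    case False
    have "w @ [c] \<notin> ending m a (Suc n)"
    proof (cases "w = []")
      case True
      then show ?thesis using assms avoidersD(1)[of "[c]" "Suc n"] by (auto simp: ending_def)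
    qed (use False in \<open>auto simp: ending_def avoiders_snoc\<close>)
    then show ?thesis using False by (auto simp: ending_def ending_above_def)
  qed
  show ?thesis
  proof (intro set_eqI iffI)
    fix x assume "x \<in> ending m a (Suc n)"
    moreover from this have "x \<noteq> []" by (auto simp: ending_def dest: avoidersD)
    ultimately show "x \<in> (\<lambda>w. w @ [a]) `
        (ending m a n \<union> ending m (a - 1) n \<union> ending_above (max (m - 1) a) n)"
      using snoc[of "butlast x" "last x"] by (intro image_eqI[of _ _ "butlast x"]) auto
  qed (use snoc in auto)
qed

lemma card_ending_Suc:
  assumes "n \<ge> 1" "1 \<le> a" "a \<le> m"
  shows "card (ending m a (Suc n)) =
    card (ending m a n) + card (ending m (a - 1) n) + card (ending_above (max (m - 1) a) n)"
proof -
  have "inj (\<lambda>w. w @ [a])"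
    by (rule injI) simp
  moreover have "ending m a n \<inter> ending m (a - 1) n = {}"
    "(ending m a n \<union> ending m (a - 1) n) \<inter> ending_above (max (m - 1) a) n = {}"
    using assms by (auto simp: ending_def ending_above_def)
  ultimately show ?thesis
    by (simp add: ending_Suc[OF assms] card_image[OF inj_on_subset] card_Un_disjoint)
qed

lemma card_ending_above:
  "card (ending_above m n) = card (ending (Suc m) (Suc m) n) + card (ending_above (Suc m) n)"
proof -
  have "ending_above m n = ending (Suc m) (Suc m) n \<union> ending_above (Suc m) n"
    using avoiders_last_le_descent_tops by (fastforce simp: ending_def ending_above_def)
  moreover have "ending (Suc m) (Suc m) n \<inter> ending_above (Suc m) n = {}"
    by (auto simp: ending_def ending_above_def)
  ultimately show ?thesis by (simp add: card_Un_disjoint)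
qed

section \<open>Generating functions by the last letter\<close>

definition ending_gf :: "nat \<Rightarrow> nat \<Rightarrow> real fps" where
  "ending_gf m a = Abs_fps (\<lambda>n. real (card (ending m a n)))"

definition above_gf :: "nat \<Rightarrow> real fps" where
  "above_gf m = Abs_fps (\<lambda>n. real (card (ending_above m n)))"

definition u :: "real fps" where "u = t / (1 - t)"
definition v :: "real fps" where "v = t / (1 - 2 * t)"

lemma fps_divide_mult_unit: "fps_nth g 0 \<noteq> 0 \<Longrightarrow> g * (f / g) = (f :: 'a :: field fps)"
  by (simp add: fps_divide_unit mult.left_commute inverse_mult_eq_1')

lemma u_eq: "(1 - t) * u = t" and v_eq: "(1 - 2 * t) * v = t"
  unfolding u_def v_def by (rule fps_divide_mult_unit; simp)+

lemma u_nth_0: "fps_nth u 0 = 0"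
  by (simp add: u_def)

lemma above_gf_nth_eq_0:
  assumes "n \<le> m"
  shows "fps_nth (above_gf m) n = 0"
proof -
  have "ending_above m n = {}"
    using assms avoiders_last_le by (fastforce simp: ending_above_def)
  then show ?thesis by (simp add: above_gf_def)
qed

lemma ending_gf_0: "ending_gf m 0 = 0"
proof -
  have "ending m 0 n = {}" for n
    using avoidersD(3) by (fastforce simp: ending_def)
  then show ?thesis
    by (intro fps_ext) (simp add: ending_gf_def)
qed

lemma above_gf_eq: "above_gf m = ending_gf (Suc m) (Suc m) + above_gf (Suc m)"
  by (rule fps_ext) (simp add: ending_gf_def above_gf_def card_ending_above[of m])

lemma ending_gf_last_letter:
  assumes "1 \<le> a" "a \<le> m"
  shows "ending_gf m a = t * ((if a = 1 then 1 else 0) + ending_gf m a + ending_gf m (a - 1) + above_gf (max (m - 1) a))"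
proof (rule fps_ext)
  fix n
  have "ending m a (Suc 0) = (if a = 1 then {[1]} else {})"
    by (auto simp: ending_def avoiders_1)
  moreover have "ending m' a' 0 = {}" "ending_above m' 0 = {}" for m' a'
    by (simp_all add: ending_def ending_above_def)
  ultimately show "fps_nth (ending_gf m a) n =
      fps_nth (t * ((if a = 1 then 1 else 0) + ending_gf m a + ending_gf m (a - 1) + above_gf (max (m - 1) a))) n"
    using card_ending_Suc[OF _ assms, of "n - 1"]
    by (cases n; cases "n - 1") (auto simp: ending_gf_def above_gf_def)
qed

text \<open>Any number of repetitions of the last letter is absorbed into \<open>u = t + t\<^sup>2 + \<dots>\<close>.\<close>

lemma ending_gf_recurrence:
  assumes "1 \<le> a" "a \<le> m"
  shows "ending_gf m a = u * ((if a = 1 then 1 else 0) + ending_gf m (a - 1) + above_gf (max (m - 1) a))"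
proof -
  define R where "R = (if a = 1 then 1 else 0) + ending_gf m (a - 1) + above_gf (max (m - 1) a)"
  have "ending_gf m a = t * (ending_gf m a + R)"
    using ending_gf_last_letter[OF assms] by (simp add: R_def add_ac)
  then have "(1 - t) * ending_gf m a = (1 - t) * (u * R)"
    using u_eq by algebra
  moreover have "1 - t \<noteq> (0 :: real fps)"
    by (auto dest!: arg_cong[of _ _ "\<lambda>f. fps_nth f 0"])
  ultimately show ?thesis by (simp add: R_def)
qed

text \<open>For \<open>a < m\<close> the down step contributes \<open>above_gf (m - 1)\<close> independently of \<open>a\<close>, so the recurrence
  can be summed as a geometric progression. The factor \<open>1 - u\<close> clears its denominator.\<close>

lemma ending_gf_below:
  "1 \<le> a \<Longrightarrow> a < m \<Longrightarrow> (1 - u) * ending_gf m a = (1 - u) * u ^ a + above_gf (m - 1) * (u - u ^ Suc a)"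
proof (induction a rule: nat_induct_at_least)
  case base
  then show ?case
    using ending_gf_recurrence[of 1 m] by (simp add: ending_gf_0 algebra_simps max_absorb1)
next
  case (Suc a)
  then have "(1 - u) * ending_gf m a = (1 - u) * u ^ a + above_gf (m - 1) * (u - u ^ Suc a)" by simp
  moreover have "ending_gf m (Suc a) = u * (ending_gf m a + above_gf (m - 1))"
    using ending_gf_recurrence[of "Suc a" m] Suc by (simp add: max_absorb1)
  moreover define p where "p = u ^ a"
  ultimately show ?case unfolding power_Suc p_def[symmetric] by algebra
qed

text \<open>Going from \<open>Suc n\<close> to \<open>n\<close> adds the words ending exactly in \<open>Suc n\<close>, and these are given by the
  previous lemma with one more step, for which the down step requires a letter above \<open>Suc n\<close>.\<close>

lemma above_gf_recurrence:
  "(1 - u - u\<^sup>2 + u\<^sup>2 * u ^ n) * above_gf n = (1 - u\<^sup>2) * above_gf (Suc n) + (1 - u) * u * u ^ n"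
proof -
  have "(1 - u) * ending_gf (Suc n) (Suc n) =
      (1 - u) * u ^ Suc n + above_gf n * (u\<^sup>2 - u\<^sup>2 * u ^ n) + (1 - u) * u * above_gf (Suc n)"
  proof (cases n)
    case 0
    then show ?thesis
      using ending_gf_recurrence[of 1 1] by (simp add: ending_gf_0 algebra_simps)
  next
    case (Suc k)
    have "(1 - u) * ending_gf (Suc n) n = (1 - u) * u ^ n + above_gf n * (u - u ^ Suc n)"
      using ending_gf_below[of n "Suc n"] Suc by simp
    moreover have "ending_gf (Suc n) (Suc n) = u * (ending_gf (Suc n) n + above_gf (Suc n))"
      using ending_gf_recurrence[of "Suc n" "Suc n"] Suc by simp
    moreover define p where "p = u ^ n"
    ultimately have "(1 - u) * ending_gf (Suc n) n = (1 - u) * p + above_gf n * (u - u * p)"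
      "ending_gf (Suc n) (Suc n) = u * (ending_gf (Suc n) n + above_gf (Suc n))"
      by simp_all
    then show ?thesis unfolding power_Suc p_def[symmetric] by algebra
  qed
  moreover define p where "p = u ^ n"
  ultimately show ?thesis
    using above_gf_eq[of n] unfolding power_Suc p_def[symmetric] by algebra
qed

section \<open>Infinite sums of power series\<close>

instance fps :: (ab_group_add) topological_comm_monoid_add
proof
  fix a b :: "'a fps"
  show "LIM x (nhds a \<times>\<^sub>F nhds b). fst x + snd x :> nhds (a + b)"
  proof (rule tendsto_fpsI)
    fix n
    have "\<forall>\<^sub>F x in nhds c. fps_nth x n = fps_nth c n" for c :: "'a fps"
      using tendsto_fps_iff[of "\<lambda>x. x" c "nhds c"] by (simp add: filterlim_ident)
    then have "\<forall>\<^sub>F x in nhds a \<times>\<^sub>F nhds b.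
        fps_nth (fst x) n = fps_nth a n \<and> fps_nth (snd x) n = fps_nth b n"
      by (intro eventually_prodI)
    then show "\<forall>\<^sub>F x in nhds a \<times>\<^sub>F nhds b. fps_nth (fst x + snd x) n = fps_nth (a + b) n"
      by eventually_elim simp
  qed
qed

lemma fps_sums_mult:
  fixes f :: "nat \<Rightarrow> 'a :: comm_ring_1 fps"
  assumes "f sums s"
  shows "(\<lambda>n. c * f n) sums (c * s)"
  unfolding sums_def
proof (rule tendsto_fpsI)
  fix n
  have "\<forall>\<^sub>F N in sequentially. \<forall>i\<in>{..n}. fps_nth (sum f {..<N}) i = fps_nth s i"
    using assms by (intro eventually_ball_finite) (auto simp: sums_def tendsto_fps_iff)
  then show "\<forall>\<^sub>F N in sequentially. fps_nth (\<Sum>k<N. c * f k) n = fps_nth (c * s) n"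
    by eventually_elim (auto simp: sum_distrib_left[symmetric] fps_mult_nth intro!: sum.cong)
qed

text \<open>The hypothesis makes \<open>f\<close> tend to \<open>0\<close> in the \<open>t\<close>-adic metric.\<close>

lemma fps_telescope_sums:
  fixes f :: "nat \<Rightarrow> 'a :: ab_group_add fps"
  assumes "\<And>n j. n < j \<Longrightarrow> fps_nth (f j) n = 0"
  shows "(\<lambda>j. f j - f (Suc j)) sums f 0"
  unfolding sums_def
proof (rule tendsto_fpsI)
  fix n
  have "(\<Sum>j<N. f j - f (Suc j)) = f 0 - f N" for N
    by (rule sum_lessThan_telescope')
  then show "\<forall>\<^sub>F N in sequentially. fps_nth (\<Sum>j<N. f j - f (Suc j)) n = fps_nth (f 0) n"
    using assms by (auto intro: eventually_mono[OF eventually_gt_at_top[of n]])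
qed

lemma fps_neq_0I: "fps_nth f 0 \<noteq> 0 \<Longrightarrow> f \<noteq> 0"
  by auto

lemma fps_geometric_sums:
  fixes y :: "real fps"
  assumes "fps_nth y 0 = 0"
  obtains s where "(\<lambda>n. y ^ n) sums s" "(1 - y) * s = 1"
proof -
  have "summable (\<lambda>n. y ^ n)"
    using assms by (intro summable_fps) (simp add: startsby_zero_power_prefix)
  then obtain s where s: "(\<lambda>n. y ^ n) sums s" by (auto simp: summable_def)
  have "(\<lambda>n. y ^ n) sums (y * s + 1)"
    using sums_Suc[of "\<lambda>n. y ^ n"] fps_sums_mult[OF s, of y] by simp
  then have "s = y * s + 1" using s sums_unique2 by blast
  then have "(1 - y) * s = 1" by (simp add: algebra_simps)
  with s that show thesis by blast
qed

section \<open>The functional equation\<close>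

text \<open>The series converges for every \<open>y\<close>, even with nonzero constant term, because a word whose last
  letter exceeds \<open>n\<close> has length greater than \<open>n\<close>. This matters for \<open>y = xt\<close>.\<close>

definition above_transform :: "real fps \<Rightarrow> real fps" where
  "above_transform y = (\<Sum>n. above_gf n * y ^ n)"

lemma above_gf_mult_nth_eq_0: "n \<le> j \<Longrightarrow> fps_nth (above_gf j * f) n = 0"
  by (auto simp: fps_mult_nth above_gf_nth_eq_0 intro!: sum.neutral)

lemma above_transform_sums: "(\<lambda>n. above_gf n * y ^ n) sums above_transform y"
  unfolding above_transform_def by (intro summable_sums summable_fps above_gf_mult_nth_eq_0) simp

lemma above_transform_sums_Suc: "(\<lambda>n. above_gf (Suc n) * y ^ Suc n) sums (above_transform y - above_gf 0)"
proof -
  have "summable (\<lambda>n. above_gf (Suc n) * y ^ Suc n)"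
    by (intro summable_fps above_gf_mult_nth_eq_0) simp
  then obtain s where s: "(\<lambda>n. above_gf (Suc n) * y ^ Suc n) sums s" by (auto simp: summable_def)
  from sums_Suc[of "\<lambda>n. above_gf n * y ^ n", OF s] have "above_transform y = s + above_gf 0"
    using above_transform_sums[of y] sums_unique2 by fastforce
  with s show ?thesis by simp
qed

text \<open>The recurrence for \<open>above_gf n\<close>, multiplied by \<open>y ^ Suc n\<close> and summed over \<open>n\<close>: the coefficient
  \<open>u ^ n\<close> turns \<open>y\<close> into \<open>u * y\<close>, and its inhomogeneous part is a geometric series, whose
  denominator \<open>1 - u * y\<close> is cleared.\<close>

lemma above_transform_functional_equation:
  "(1 - u * y) * ((1 - u - u\<^sup>2) * y * above_transform y + u\<^sup>2 * y * above_transform (u * y)) =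
   (1 - u * y) * ((1 - u\<^sup>2) * (above_transform y - above_gf 0)) + (1 - u) * u * y"
proof -
  obtain g where g: "(\<lambda>n. (u * y) ^ n) sums g" "(1 - u * y) * g = 1"
    by (rule fps_geometric_sums[of "u * y"]) (simp add: u_nth_0)
  have "(\<lambda>n. (1 - u - u\<^sup>2) * y * (above_gf n * y ^ n) + u\<^sup>2 * y * (above_gf n * (u * y) ^ n)) sums
      ((1 - u - u\<^sup>2) * y * above_transform y + u\<^sup>2 * y * above_transform (u * y))"
    by (intro sums_add fps_sums_mult above_transform_sums)
  moreover have "(1 - u - u\<^sup>2) * y * (above_gf n * y ^ n) + u\<^sup>2 * y * (above_gf n * (u * y) ^ n) =
      (1 - u\<^sup>2) * (above_gf (Suc n) * y ^ Suc n) + (1 - u) * u * y * (u * y) ^ n" for n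
  proof -
    have "(1 - u - u\<^sup>2) * y * (above_gf n * y ^ n) + u\<^sup>2 * y * (above_gf n * (u * y) ^ n) =
        ((1 - u - u\<^sup>2 + u\<^sup>2 * u ^ n) * above_gf n) * y ^ Suc n"
      by (simp add: power_mult_distrib algebra_simps)
    also have "\<dots> = (1 - u\<^sup>2) * (above_gf (Suc n) * y ^ Suc n) + (1 - u) * u * y * (u * y) ^ n"
      unfolding above_gf_recurrence by (simp add: power_mult_distrib algebra_simps)
    finally show ?thesis .
  qed
  moreover have "(\<lambda>n. (1 - u\<^sup>2) * (above_gf (Suc n) * y ^ Suc n) + (1 - u) * u * y * (u * y) ^ n) sums
      ((1 - u\<^sup>2) * (above_transform y - above_gf 0) + (1 - u) * u * y * g)"
    by (intro sums_add fps_sums_mult above_transform_sums_Suc g)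
  ultimately have "(1 - u - u\<^sup>2) * y * above_transform y + u\<^sup>2 * y * above_transform (u * y) =
      (1 - u\<^sup>2) * (above_transform y - above_gf 0) + (1 - u) * u * y * g"
    using sums_unique2 by simp
  then show ?thesis using g(2) by algebra
qed

text \<open>By summation by parts, this is the sum over \<open>a \<ge> 1\<close> of \<open>y\<^sup>a\<close> times the generating function of the
  avoiders ending in \<open>a\<close>, that is, of \<open>(above_gf (a - 1) - above_gf a) * y ^ a\<close>. The iteration below takes
  its simplest form in terms of this series.\<close>

definition letter_transform :: "real fps \<Rightarrow> real fps" where
  "letter_transform y = above_gf 0 - (1 - y) * above_transform y"

text \<open>This is \<open>(1 - y) * k_fps y\<close> with the denominator \<open>1 - y\<close> cleared, so that it is also
  meaningful at \<open>y = xt\<close>, where \<open>1 - y\<close> is not invertible.\<close>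

definition kernel :: "real fps \<Rightarrow> real fps" where
  "kernel y = (1 - y) + y\<^sup>2 * t + y * (1 - y) * (t ^ 3 / ((1 - t) * (1 - 2 * t)))"

lemma kernel_factors:
  "(1 - t) * (1 - 2 * t) * kernel y = (1 - t - t * y) * (1 - 2 * t - (1 - 3 * t + t\<^sup>2) * y)"
proof -
  define c :: "real fps" where "c = t ^ 3 / ((1 - t) * (1 - 2 * t))"
  have "(1 - t) * (1 - 2 * t) * c = t ^ 3"
    unfolding c_def by (rule fps_divide_mult_unit) simp
  then show ?thesis unfolding kernel_def c_def[symmetric] by algebra
qed

text \<open>The factor \<open>1 - t - t * y\<close> of the kernel is \<open>(1 - t) * (1 - u * y)\<close>. It is the denominator that the
  geometric series left in the equation for \<open>above_transform\<close>; up to a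
  unit, the other factor is the coefficient of \<open>above_transform y\<close> there.\<close>

lemma letter_transform_functional_equation:
  "letter_transform y * kernel y = t * y * (1 - y + above_gf 0 + v * (1 - y) * letter_transform (u * y))"
proof -
  have "(1 - t) ^ 2 * (1 - 2 * t) * (letter_transform y * kernel y) =
      (1 - t) ^ 2 * (1 - 2 * t) * (t * y * (1 - y + above_gf 0 + v * (1 - y) * letter_transform (u * y)))"
    using above_transform_functional_equation[of y] kernel_factors[of y] u_eq v_eq
    unfolding letter_transform_def by algebra
  moreover have "(1 - t) ^ 2 * (1 - 2 * t) \<noteq> (0 :: real fps)"
    by (rule fps_neq_0I) simp
  ultimately show ?thesis by simp
qed

text \<open>The radicand is a perfect square; the constant term \<open>1\<close> decides the sign of its root.\<close>

lemma xt_eq: "(1 - 3 * t + t\<^sup>2) * xt = 1 - 2 * t"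
proof -
  define S where "S = fps_radical root 2 radicand"
  have S: "S\<^sup>2 = (1 - 5 * t + 6 * t\<^sup>2 - t ^ 3)\<^sup>2" "fps_nth S 0 = 1"
    using radicand_sqrt unfolding S_def[symmetric]
    by (simp_all add: radicand_def power2_eq_square algebra_simps eval_nat_numeral)
  have "S + (1 - 5 * t + 6 * t\<^sup>2 - t ^ 3) \<noteq> 0"
    by (rule fps_neq_0I) (simp add: S(2))
  with S(1) have "S = 1 - 5 * t + 6 * t\<^sup>2 - t ^ 3"
    by (metis add_eq_0_iff2 power2_eq_iff)
  then have "2 * t * ((1 - 3 * t + t\<^sup>2) * xt) = 2 * t * (1 - 2 * t)"
    using xt_exact unfolding S_def[symmetric] by algebra
  then show ?thesis by simp
qed

lemma xt_nth_0: "fps_nth xt 0 = 1"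
  using arg_cong[OF xt_eq, of "\<lambda>f. fps_nth f 0"] by simp

lemma kernel_xt: "kernel xt = 0"
proof -
  have "(1 - t) * (1 - 2 * t) * kernel xt = 0"
    unfolding kernel_factors xt_eq by simp
  moreover have "(1 - t) * (1 - 2 * t) \<noteq> (0 :: real fps)"
    by (rule fps_neq_0I) simp
  ultimately show ?thesis by simp
qed

text \<open>The functional equation at the root of the kernel.\<close>

lemma above_gf_0_eq: "above_gf 0 = (xt - 1) * (1 + v * letter_transform (u * xt))"
proof -
  have "t * xt \<noteq> 0"
    using xt_nth_0 by auto
  then have "1 - xt + above_gf 0 + v * (1 - xt) * letter_transform (u * xt) = 0"
    using letter_transform_functional_equation[of xt] kernel_xt by simp
  then show ?thesis by algebra
qed

section \<open>Iterating the functional equation\<close>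

text \<open>The iterates of the kernel root under \<open>y \<mapsto> u * y\<close>.\<close>

definition orbit :: "nat \<Rightarrow> real fps" where
  "orbit j = xt * u ^ j"

lemma orbit_nth_0: "j \<ge> 1 \<Longrightarrow> fps_nth (orbit j) 0 = 0"
  by (simp add: orbit_def u_nth_0)

lemma orbit_Suc: "u * orbit j = orbit (Suc j)"
  by (simp add: orbit_def)

lemma u_power: "(1 - t) ^ j * u ^ j = t ^ j"
  by (simp add: power_mult_distrib[symmetric] u_eq)

lemma orbit_eq: "xt * t ^ j / (1 - t) ^ j = orbit j"
proof -
  have "(1 - t) ^ j * (xt * t ^ j / (1 - t) ^ j) = (1 - t) ^ j * orbit j"
    using u_power[of j] fps_divide_mult_unit[of "(1 - t) ^ j" "xt * t ^ j"]
    by (simp add: orbit_def mult.left_commute)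
  moreover have "(1 - t) ^ j \<noteq> (0 :: real fps)"
    by (rule fps_neq_0I) simp
  ultimately show ?thesis by simp
qed

lemma k_fps_kernel:
  assumes "fps_nth y 0 = 0"
  shows "k_fps y * (1 - y) = kernel y"
proof -
  have "(1 - y) * (y\<^sup>2 * t / (1 - y)) = y\<^sup>2 * t"
    by (rule fps_divide_mult_unit) (simp add: assms)
  moreover have "y * t ^ 3 / ((1 - t) * (1 - 2 * t)) = y * (t ^ 3 / ((1 - t) * (1 - 2 * t)))"
    by (simp add: fps_divide_unit mult.assoc)
  ultimately show ?thesis
    by (simp add: k_fps_def kernel_def algebra_simps)
qed

definition den :: "nat \<Rightarrow> real fps" where
  "den j = (1 - t) ^ ((j + 1) choose 2) * (1 - 2 * t) ^ j * (\<Prod>i=1..j. k_fps (orbit i))"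

lemma num_term_eq: "num_term j = t ^ ((j choose 2) + 3 * j) * xt ^ j / den j"
  by (simp add: num_term_def den_def orbit_eq)

lemma den_nth_0: "fps_nth (den j) 0 = 1"
  using prod_k_nth_0[of j] by (simp add: den_def orbit_eq fps_power_zeroth)

lemma den_mult_num_term: "den j * num_term j = t ^ ((j choose 2) + 3 * j) * xt ^ j"
  unfolding num_term_eq by (rule fps_divide_mult_unit) (simp add: den_nth_0)

lemma num_term_0: "num_term 0 = 1"
  using den_mult_num_term[of 0] by (simp add: den_def numeral_2_eq_2)

text \<open>In the functional equation at \<open>y = orbit (Suc j)\<close> the coefficient of \<open>v * letter_transform (u * y)\<close>,
  multiplied by \<open>v\<close>, is \<open>v * t * y / k_fps y\<close>. Hence \<open>num_term j\<close> is the product of these coefficients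
  over the first \<open>j\<close> points. The exponents match because \<open>v * t * y\<close> contributes
  \<open>t\<^sup>2 * t\<^sup>j\<^sup>+\<^sup>1\<close>, and \<open>(j + 1 choose 2) + 3 * (j + 1)\<close> exceeds \<open>(j choose 2) + 3 * j\<close> by \<open>j + 3\<close>.\<close>

lemma num_term_Suc:
  "num_term (Suc j) * k_fps (orbit (Suc j)) = num_term j * (v * t * orbit (Suc j))"
proof -
  have den: "den (Suc j) = den j * ((1 - t) ^ Suc j * (1 - 2 * t) * k_fps (orbit (Suc j)))"
    by (simp add: den_def numeral_2_eq_2 power_add algebra_simps)
  have "den j * (1 - t) ^ Suc j * (1 - 2 * t) * (num_term (Suc j) * k_fps (orbit (Suc j))) =
      den (Suc j) * num_term (Suc j)"
    unfolding den by (simp only: mult_ac)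
  also have "\<dots> = (den j * num_term j) * (t ^ Suc j * t * t * xt)"
    unfolding den_mult_num_term by (simp add: numeral_2_eq_2 numeral_3_eq_3 power_add mult_ac)
  also have "\<dots> = (den j * num_term j) *
      (((1 - t) ^ Suc j * u ^ Suc j) * ((1 - 2 * t) * v) * t * xt)"
    unfolding u_power v_eq by (simp only: mult_ac)
  also have "\<dots> = den j * (1 - t) ^ Suc j * (1 - 2 * t) * (num_term j * (v * t * orbit (Suc j)))"
    by (simp only: orbit_def mult_ac)
  finally have "den j * (1 - t) ^ Suc j * (1 - 2 * t) * (num_term (Suc j) * k_fps (orbit (Suc j))) =
      den j * (1 - t) ^ Suc j * (1 - 2 * t) * (num_term j * (v * t * orbit (Suc j)))" .
  moreover have "den j * (1 - t) ^ Suc j * (1 - 2 * t) \<noteq> 0"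
    by (rule fps_neq_0I) (simp add: den_nth_0)
  ultimately show ?thesis by simp
qed

lemma den_term_eq:
  assumes "j \<ge> 1"
  shows "den_term j * (1 - orbit j) = num_term j"
proof -
  define D where "D = (1 - t) ^ (j choose 2) * (1 - 2 * t) ^ j * ((1 - t) ^ j - xt * t ^ j) *
      (\<Prod>i=1..j. k_fps (orbit i))"
  have "(1 - t) ^ j - xt * t ^ j = (1 - t) ^ j * (1 - orbit j)"
    unfolding orbit_def u_power[symmetric] by (simp add: algebra_simps)
  then have D: "D = den j * (1 - orbit j)"
    by (simp add: D_def den_def numeral_2_eq_2 power_add mult_ac)
  then have "fps_nth D 0 = 1"
    using assms by (simp add: den_nth_0 orbit_nth_0)
  have "D * den_term j = t ^ ((j choose 2) + 3 * j) * xt ^ j"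
    unfolding den_term_def orbit_eq D_def[symmetric]
    by (rule fps_divide_mult_unit) (simp add: \<open>fps_nth D 0 = 1\<close>)
  then have "den j * (den_term j * (1 - orbit j)) = den j * num_term j"
    unfolding den_mult_num_term D by (simp only: mult_ac)
  moreover have "den j \<noteq> 0"
    by (rule fps_neq_0I) (simp add: den_nth_0)
  ultimately show ?thesis by simp
qed

text \<open>The explicit power of \<open>t\<close> makes the remainder of the iteration vanish in the limit.\<close>

lemma num_term_mult_nth_eq_0:
  assumes "n < j"
  shows "fps_nth (num_term j * f) n = 0"
proof -
  have "num_term j * f = t ^ ((j choose 2) + 3 * j) * (xt ^ j * inverse (den j) * f)"
    unfolding num_term_eq by (subst fps_divide_unit) (simp_all add: den_nth_0 mult.assoc)
  with assms show ?thesis by (simp only: fps_X_power_mult_nth) simp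
qed

text \<open>The functional equation at \<open>orbit (Suc j)\<close>, divided by the kernel and written as a difference of
  consecutive remainders so that its sum over \<open>j\<close> telescopes.\<close>

lemma iteration_step:
  "num_term j * (v * letter_transform (orbit (Suc j))) - num_term (Suc j) * (v * letter_transform (orbit (Suc (Suc j)))) =
   num_term (Suc j) + above_gf 0 * den_term (Suc j)"
proof -
  let ?y = "orbit (Suc j)"
  have "letter_transform ?y * (k_fps ?y * (1 - ?y)) = t * ?y * (1 - ?y + above_gf 0 + v * (1 - ?y) * letter_transform (orbit (Suc (Suc j))))"
    using letter_transform_functional_equation[of ?y] k_fps_kernel[of ?y] by (simp add: orbit_nth_0 orbit_Suc)
  then have "k_fps ?y * (1 - ?y) *
      (num_term j * (v * letter_transform ?y) - num_term (Suc j) * (v * letter_transform (orbit (Suc (Suc j))))) =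
      k_fps ?y * (1 - ?y) * (num_term (Suc j) + above_gf 0 * den_term (Suc j))"
    using num_term_Suc[of j] den_term_eq[of "Suc j", simplified] by algebra
  moreover have "k_fps ?y * (1 - ?y) \<noteq> 0"
    by (rule fps_neq_0I) (simp add: k_fps_nth_0 orbit_nth_0)
  ultimately show ?thesis by simp
qed

lemma letter_transform_orbit_eq: "v * letter_transform (u * xt) = (\<Sum>j. num_term (Suc j)) + above_gf 0 * (\<Sum>j. den_term (Suc j))"
proof -
  have "(\<lambda>j. num_term j * (v * letter_transform (orbit (Suc j))) - num_term (Suc j) * (v * letter_transform (orbit (Suc (Suc j)))))
      sums (num_term 0 * (v * letter_transform (orbit (Suc 0))))"
    by (rule fps_telescope_sums) (rule num_term_mult_nth_eq_0)
  then have "(\<lambda>j. num_term (Suc j) + above_gf 0 * den_term (Suc j)) sums (v * letter_transform (u * xt))"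
    unfolding iteration_step by (simp add: num_term_0 orbit_def mult.commute)
  moreover have "(\<lambda>j. num_term (Suc j) + above_gf 0 * den_term (Suc j)) sums
      ((\<Sum>j. num_term (Suc j)) + above_gf 0 * (\<Sum>j. den_term (Suc j)))"
    by (intro sums_add fps_sums_mult summable_sums summable_terms)
  ultimately show ?thesis by (rule sums_unique2)
qed

theorem theorem3p3:
  shows "Abs_fps (\<lambda>n. if n \<ge> 1 then real (avoid_count (2, 1, 3) n) else 0) =
    (xt - 1) * (1 + (\<Sum>j. num_term (Suc j))) /
    (1 + (1 - xt) * (\<Sum>j. den_term (Suc j)))"
proof -
  define N D where "N = (\<Sum>j. num_term (Suc j))" and "D = (\<Sum>j. den_term (Suc j))"
  have "ending_above 0 n = avoiders n" for n
    by (auto simp: ending_above_def dest: avoidersD(3))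
  then have "Abs_fps (\<lambda>n. if n \<ge> 1 then real (avoid_count (2, 1, 3) n) else 0) = above_gf 0"
    by (auto simp: above_gf_def fps_eq_iff avoid_count_def avoiders_def[symmetric] not_le
        simp del: One_nat_def)
  moreover have "above_gf 0 * (1 + (1 - xt) * D) = (xt - 1) * (1 + N)"
    using above_gf_0_eq letter_transform_orbit_eq unfolding N_def D_def by algebra
  moreover have "1 + (1 - xt) * D \<noteq> 0"
    by (rule fps_neq_0I) (simp add: xt_nth_0)
  ultimately show ?thesis
    unfolding N_def[symmetric] D_def[symmetric] by (metis nonzero_mult_div_cancel_right)
qed

end
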